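(* Let $K$ be a convex body contained in the interior of the unit disc of $\mathbb{R}^2$ centred at the origin. Suppose that the set $C(K,x)\cap x^{\bot}$ is, for every unit vector $x\in\mathbb{S}^1$, a segment of constant length (i.e., of length independent of $x$). Then $K$ is a Euclidean disc.
   Context: A convex body is a compact convex set with non-empty interior. For a convex body $K\subset\mathbb{R}^2$ and a point $x\in\mathbb{R}^2\setminus K$, $C(K,x)=\{x+\lambda(y-x): y\in K,\ \lambda\geq 0\}$ is the cone generated by $K$ with apex $x$. $x^{\bot}$ denotes the line through the origin orthogonal to $x$. *)

theory Defs
  imports "HOL-Analysis.Analysis"
begin

definition convex_body :: "'a::euclidean_space set \<Rightarrow> bool" where
  "convex_body K \<longleftrightarrow> compact K \<and> convex K \<and> interior K \<noteq> {}"

definition apex_cone :: "'a::real_vector set \<Rightarrow> 'a \<Rightarrow> 'a set" where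
  "apex_cone K x = {x + t *\<^sub>R (y - x) | y t. y \<in> K \<and> 0 \<le> t}"

end

theory Submission
  imports Defs
begin

text \<open>
  For a unit vector \<open>x\<close> let \<open>M\<close> and \<open>m\<close> be the signed extreme coordinates of the segment cut out
  on the line orthogonal to \<open>x\<close>, so \<open>M - m = L\<close>. A tangent line of \<open>K\<close> through \<open>x\<close> meets the circle
  again at a point \<open>x'\<close>; the triangle \<open>0, x, x'\<close> is isosceles, so \<open>m(x') = -M(x)\<close> and hence
  \<open>M(x') = L - M(x)\<close>. Applying this twice, \<open>M\<close> is invariant under the map that rotates \<open>x\<close> by
  the angle \<open>2 pi - 2 (arctan M + arctan (L - M))\<close>, where \<open>M = M(x)\<close>. A continuous periodic
  displacement that is invariant under its own translation is constant, because iterates of a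
  nonconstant one would spread a small arc over the whole circle. Therefore
  \<open>arctan M + arctan (L - M)\<close> is constant, which by Rolle's theorem forces \<open>M\<close> to be constant.
  So all support lines of \<open>K\<close> have the same distance from the origin.
\<close>

section \<open>Real analysis: suprema, periodic functions and arctangents\<close>

text \<open>Compactness of \<open>C\<close> makes \<open>f (x, y)\<close> close to
  \<open>f (x0, y)\<close> uniformly in \<open>y\<close>, and a uniform change by at most
  \<open>e\<close> moves the supremum by at most \<open>e\<close>.\<close>

lemma continuous_on_SUP_compact:
  fixes f :: "'a::topological_space \<times> 'b::topological_space \<Rightarrow> real"
  assumes f: "continuous_on (U \<times> C) f" and C: "compact C" "C \<noteq> {}"
  shows "continuous_on U (\<lambda>x. SUP y\<in>C. f (x, y))"
proof -
  have bdd: "bdd_above ((\<lambda>y. f (x, y)) ` C)" if "x \<in> U" for x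
  proof -
    have "continuous_on C (\<lambda>y. f (x, y))"
      using that by (intro continuous_on_compose2[OF f] continuous_intros) auto
    then show ?thesis
      by (intro bounded_imp_bdd_above compact_imp_bounded compact_continuous_image C(1))
  qed
  have le: "(SUP y\<in>C. f (x, y)) \<le> (SUP y\<in>C. f (x', y)) + e"
    if "x \<in> U" "x' \<in> U" "\<forall>y\<in>C. dist (f (x, y)) (f (x', y)) \<le> e" for x x' e
  proof (rule cSUP_least[OF C(2)])
    fix y assume y: "y \<in> C"
    then have "f (x, y) \<le> f (x', y) + e"
      using that(3) by (fastforce simp: dist_real_def)
    also have "f (x', y) \<le> (SUP y\<in>C. f (x', y))"
      using cSUP_upper[OF y bdd[OF that(2)]] .
    finally show "f (x, y) \<le> (SUP y\<in>C. f (x', y)) + e" by simp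
  qed
  show ?thesis
    unfolding continuous_on_def
  proof (intro ballI tendstoI)
    fix x0 and e :: real
    assume x0: "x0 \<in> U" and e: "0 < e"
    obtain X where X: "x0 \<in> X" "open X" "\<forall>x\<in>X \<inter> U. \<forall>y\<in>C. dist (f (x, y)) (f (x0, y)) \<le> e / 2"
      by (rule continuous_on_prod_compactE[OF f C(1) x0 half_gt_zero[OF e]])
    have "dist (SUP y\<in>C. f (x, y)) (SUP y\<in>C. f (x0, y)) < e" if "x \<in> X" "x \<in> U" for x
    proof -
      have "\<forall>y\<in>C. dist (f (x, y)) (f (x0, y)) \<le> e / 2" using X(3) that by blast
      then show ?thesis
        using le[of x x0 "e / 2"] le[of x0 x "e / 2"] that(2) x0 e
        by (simp add: dist_commute) (simp add: dist_real_def)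
    qed
    then show "\<forall>\<^sub>F x in at x0 within U. dist (SUP y\<in>C. f (x, y)) (SUP y\<in>C. f (x0, y)) < e"
      using X(1,2) by (auto simp: eventually_at_topological)
  qed
qed

lemma periodic_add_of_nat:
  fixes f :: "real \<Rightarrow> 'a"
  assumes "\<And>t. f (t + p) = f t"
  shows "f (t + of_nat n * p) = f t"
proof (induction n)
  case (Suc n)
  then show ?case using assms[of "t + of_nat n * p"] by (simp add: algebra_simps)
qed simp

lemma periodic_add_of_int:
  fixes f :: "real \<Rightarrow> 'a"
  assumes "\<And>t. f (t + p) = f t"
  shows "f (t + of_int k * p) = f t"
proof (cases "k \<ge> 0")
  case True
  then show ?thesis using periodic_add_of_nat[of f p t "nat k"] assms by simp
next
  case False
  then show ?thesis
    using periodic_add_of_nat[of f p "t + of_int k * p" "nat (- k)"] assms by simp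
qed

text \<open>Iterating \<open>inv\<close> gives \<open>f (t + n * f t) = f t\<close>. If
  \<open>f\<close> were not constant, \<open>t + n * f t\<close> for large \<open>n\<close> would
  stretch an interval on which \<open>f\<close> stays above \<open>f a\<close> over a full period,
  so it would hit a translate of \<open>a\<close>, where \<open>f\<close> equals
  \<open>f a\<close>.\<close>

lemma self_translation_invariant_constant:
  fixes f :: "real \<Rightarrow> real"
  assumes cont: "continuous_on UNIV f" and p: "0 < p"
    and per: "\<And>t. f (t + p) = f t"
    and inv: "\<And>t. f (t + f t) = f t"
  shows "f s = f t"
proof -
  have iter: "f (t + of_nat n * f t) = f t" for t n
  proof (induction n)
    case (Suc n)
    then show ?case using inv[of "t + of_nat n * f t"] by (simp add: algebra_simps)
  qed simp
  have False if less: "f a < f b0" for a b0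
  proof -
    obtain k :: nat where k: "(a - b0) / p < k" using reals_Archimedean2 by blast
    \<comment> \<open>Moving \<open>b0\<close> by whole periods to the right of \<open>a\<close>
      keeps its value and orders the two points for the intermediate value theorem.\<close>
    define b where "b = b0 + k * p"
    have ab: "a < b" using k p by (simp add: b_def field_simps)
    have fb: "f b = f b0" unfolding b_def by (rule periodic_add_of_nat[of f p, OF per])
    define m where "m = (f a + f b) / 2"
    have m: "f a < m" "m < f b" using less fb by (auto simp: m_def)
    \<comment> \<open>The greatest element \<open>c\<close> of this level set is the last time that
      \<open>f\<close> takes the value \<open>m\<close> before \<open>b\<close>; from there on
      \<open>f\<close> stays at least \<open>m\<close>.\<close>
    define Z where "Z = {a..b} \<inter> f -` {m}"
    have "compact Z" unfolding Z_def
      by (intro compact_Int_closed closed_vimage) (auto simp: cont)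
    moreover have "Z \<noteq> {}"
      using IVT'[of f a m b] m ab continuous_on_subset[OF cont] by (fastforce simp: Z_def)
    ultimately obtain c where c: "c \<in> Z" "\<And>z. z \<in> Z \<Longrightarrow> z \<le> c"
      using compact_attains_sup[of Z] by blast
    have ge: "m \<le> f t" if t: "c \<le> t" "t \<le> b" for t
    proof (rule ccontr)
      assume "\<not> m \<le> f t"
      then obtain z where z: "t \<le> z" "z \<le> b" "f z = m"
        using IVT'[of f t m b] m t continuous_on_subset[OF cont] by force
      then have "z \<in> Z" using c(1) t by (auto simp: Z_def)
      then have "z = t" using c(2)[of z] z t by simp
      then show False using z \<open>\<not> m \<le> f t\<close> by simp
    qed
    have cb: "c \<le> b" "f c = m" using c(1) by (auto simp: Z_def)
    \<comment> \<open>With this \<open>n\<close>, the values at \<open>c\<close> and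
      \<open>b\<close> alone push the endpoints apart by more than \<open>p\<close>.\<close>
    obtain n :: nat where n: "p / (f b - m) < n" using reals_Archimedean2 by blast
    define G where "G t = t + n * f t" for t
    have spread: "G c + p \<le> G b"
      using n m cb by (simp add: G_def field_simps)
    \<comment> \<open>The first translate of \<open>a\<close> by periods that is not below
      \<open>G c\<close>; it is less than \<open>G c + p\<close>, hence below
      \<open>G b\<close>.\<close>
    define j where "j = \<lceil>(G c - a) / p\<rceil>"
    have "(G c - a) / p \<le> j" "j < (G c - a) / p + 1" unfolding j_def by linarith+
    then have j: "G c \<le> a + j * p" "a + j * p \<le> G b"
      using p spread by (auto simp: field_simps)
    have "continuous_on {c..b} G"
      unfolding G_def by (intro continuous_intros continuous_on_subset[OF cont]) auto
    then obtain t where t: "c \<le> t" "t \<le> b" "G t = a + j * p"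
      using IVT'[of G c _ b] j cb by blast
    have "f t = f (G t)" by (simp add: G_def iter)
    also have "\<dots> = f a" unfolding t(3) by (rule periodic_add_of_int[of f p, OF per])
    finally show False using ge[OF t(1,2)] m by simp
  qed
  then show ?thesis by (meson linorder_neqE_linordered_idom)
qed

text \<open>Rolle gives a zero of the derivative strictly between \<open>u\<close> and
  \<open>v\<close>, and for \<open>L \<noteq> 0\<close> its only zero is \<open>L / 2\<close>. Hence
  no three distinct arguments can share one value.\<close>

lemma arctan_sum_stationary:
  fixes L u v :: real
  assumes "L \<noteq> 0" "u < v" and "arctan u + arctan (L - u) = arctan v + arctan (L - v)"
  shows "u < L / 2 \<and> L / 2 < v"
proof -
  have D: "((\<lambda>x. arctan x + arctan (L - x)) has_real_derivative
            inverse (1 + x\<^sup>2) - inverse (1 + (L - x)\<^sup>2)) (at x)" for x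
    by (auto intro!: derivative_eq_intros)
  have "\<exists>z>u. z < v \<and> (\<lambda>h. (inverse (1 + z\<^sup>2) - inverse (1 + (L - z)\<^sup>2)) * h) = (\<lambda>h. 0)"
    using D
    by (intro Rolle_deriv[where f = "\<lambda>x. arctan x + arctan (L - x)"] assms continuous_intros)
      (auto simp: has_field_derivative_def)
  then obtain z where z0: "u < z" "z < v" "inverse (1 + z\<^sup>2) - inverse (1 + (L - z)\<^sup>2) = 0"
    by (metis mult.right_neutral)
  then obtain z where z: "u < z" "z < v" "(L - z)\<^sup>2 = z\<^sup>2" by auto
  then have "z = L / 2" using assms(1) by (auto simp: power2_eq_iff)
  then show ?thesis using z by simp
qed

section \<open>Polar coordinates in the plane\<close>

definition polar_dir :: "real \<Rightarrow> real ^ 2" where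
  "polar_dir t = vector [cos t, sin t]"

lemma inner_polar_dir: "y \<bullet> polar_dir t = y $ 1 * cos t + y $ 2 * sin t"
  by (simp add: polar_dir_def inner_vec_def sum_2)

lemma polar_dir_inner_polar_dir: "polar_dir s \<bullet> polar_dir t = cos (s - t)"
  by (simp add: inner_polar_dir) (simp add: polar_dir_def cos_diff)

lemma norm_polar_dir [simp]: "norm (polar_dir t) = 1"
  by (simp add: norm_eq_sqrt_inner polar_dir_inner_polar_dir)

lemma polar_dir_periodic: "polar_dir (t + 2 * pi) = polar_dir t"
  by (simp add: polar_dir_def)

lemma polar_decomposition:
  obtains t where "v = norm v *\<^sub>R polar_dir t"
proof (cases "v = 0")
  case False
  have "(v $ 1)\<^sup>2 + (v $ 2)\<^sup>2 = (norm v)\<^sup>2"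
    unfolding power2_norm_eq_inner by (simp add: inner_vec_def sum_2 power2_eq_square)
  then have "(v $ 1 / norm v)\<^sup>2 + (v $ 2 / norm v)\<^sup>2 = 1"
    using False by (simp add: power_divide flip: add_divide_distrib)
  then obtain t where "v $ 1 / norm v = cos t" "v $ 2 / norm v = sin t"
    using sincos_total_2pi by metis
  then have "norm v * cos t = norm v * (v $ 1 / norm v)" "norm v * sin t = norm v * (v $ 2 / norm v)"
    by metis+
  then have "norm v * cos t = v $ 1" "norm v * sin t = v $ 2"
    using False by simp_all
  then show ?thesis
    by (intro that[of t]) (simp add: polar_dir_def vec_eq_iff forall_2)
qed (use that in simp)

lemma orthonormal_polar_frame:
  "y = (y \<bullet> polar_dir t) *\<^sub>R polar_dir t + (y \<bullet> polar_dir (t + pi / 2)) *\<^sub>R polar_dir (t + pi / 2)"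
proof -
  have "cos t * cos t + sin t * sin t = 1" by (rule sin_cos_squared_add3)
  then have "a = (a * cos t + b * sin t) * cos t + (b * cos t - a * sin t) * - sin t"
    and "b = (a * cos t + b * sin t) * sin t + (b * cos t - a * sin t) * cos t" for a b
    by algebra+
  from this[where a = "y $ 1" and b = "y $ 2"] show ?thesis
    by (simp add: vec_eq_iff forall_2 inner_polar_dir cos_add sin_add)
      (simp add: polar_dir_def cos_add sin_add algebra_simps)
qed

section \<open>Central projection from a point of the unit circle\<close>

text \<open>The line from the apex \<open>polar_dir t\<close> through \<open>y\<close> meets the
  orthogonal line through the origin in a point; this is its signed coordinate along
  \<open>polar_dir (t + pi / 2)\<close>.\<close>

definition proj_coord :: "real \<Rightarrow> real ^ 2 \<Rightarrow> real" where
  "proj_coord t y = (y \<bullet> polar_dir (t + pi / 2)) / (1 - y \<bullet> polar_dir t)"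

lemma inner_polar_dir_less_1: "norm y < 1 \<Longrightarrow> y \<bullet> polar_dir t < 1"
  using norm_cauchy_schwarz[of y "polar_dir t"] by simp

text \<open>On the ray from the apex \<open>x\<close> through \<open>y\<close>, orthogonality to
  \<open>x\<close> forces the parameter \<open>1 / (1 - y \<bullet> x)\<close>, which is positive
  because \<open>y\<close> lies in the open disc. So each \<open>y\<close> contributes exactly one
  point.\<close>

lemma apex_cone_section:
  assumes K: "\<And>y. y \<in> K \<Longrightarrow> norm y < 1"
  shows "apex_cone K (polar_dir t) \<inter> {y. orthogonal (polar_dir t) y}
       = (\<lambda>y. proj_coord t y *\<^sub>R polar_dir (t + pi / 2)) ` K"
proof -
  let ?x = "polar_dir t" and ?u = "polar_dir (t + pi / 2)"
  have orth: "?x \<bullet> (?x + l *\<^sub>R (y - ?x)) = 1 - l * (1 - y \<bullet> ?x)" for l y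
    by (simp add: inner_add_right inner_diff_right polar_dir_inner_polar_dir inner_commute algebra_simps)
  have pt: "?x + (1 / (1 - y \<bullet> ?x)) *\<^sub>R (y - ?x) = proj_coord t y *\<^sub>R ?u" if "y \<in> K" for y
  proof -
    have nz: "1 - y \<bullet> ?x \<noteq> 0" using inner_polar_dir_less_1[OF K[OF that], of t] by simp
    have "(1 - y \<bullet> ?x) *\<^sub>R (?x + (1 / (1 - y \<bullet> ?x)) *\<^sub>R (y - ?x))
        = (1 - y \<bullet> ?x) *\<^sub>R ?x + (y - ?x)"
      using nz by (simp add: scaleR_add_right)
    also have "\<dots> = y - (y \<bullet> ?x) *\<^sub>R ?x" by (simp add: algebra_simps)
    also have "\<dots> = (y \<bullet> ?u) *\<^sub>R ?u" using orthonormal_polar_frame[of y t] by (simp add: algebra_simps)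
    also have "\<dots> = (1 - y \<bullet> ?x) *\<^sub>R (proj_coord t y *\<^sub>R ?u)"
      using nz by (simp add: proj_coord_def)
    finally show ?thesis using nz by (metis scaleR_cancel_left)
  qed
  show ?thesis
  proof (intro equalityI subsetI)
    fix z assume z: "z \<in> apex_cone K ?x \<inter> {y. orthogonal ?x y}"
    then obtain y l where y: "y \<in> K" "z = ?x + l *\<^sub>R (y - ?x)" by (auto simp: apex_cone_def)
    then have "l * (1 - y \<bullet> ?x) = 1" using z orth[of l y] by (simp add: orthogonal_def)
    then have "l = 1 / (1 - y \<bullet> ?x)" by (metis mult_zero_right nonzero_eq_divide_eq zero_neq_one)
    then show "z \<in> (\<lambda>y. proj_coord t y *\<^sub>R ?u) ` K" using y pt by auto
  next
    fix z assume "z \<in> (\<lambda>y. proj_coord t y *\<^sub>R ?u) ` K"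
    then obtain y where y: "y \<in> K" "z = ?x + (1 / (1 - y \<bullet> ?x)) *\<^sub>R (y - ?x)" using pt by auto
    have less: "y \<bullet> ?x < 1" using inner_polar_dir_less_1[OF K[OF y(1)]] .
    then have "orthogonal ?x z" using orth[of "1 / (1 - y \<bullet> ?x)" y] y(2) by (simp add: orthogonal_def)
    moreover have "z \<in> apex_cone K ?x"
      unfolding apex_cone_def using y less
      by (intro CollectI exI[of _ y] exI[of _ "1 / (1 - y \<bullet> ?x)"]) auto
    ultimately show "z \<in> apex_cone K ?x \<inter> {y. orthogonal ?x y}" by simp
  qed
qed

text \<open>The line through \<open>polar_dir t\<close> that cuts the orthogonal line at coordinate
  \<open>tan \<alpha>\<close> has unit normal at angle \<open>t + pi / 2 - \<alpha>\<close> and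
  offset \<open>sin \<alpha>\<close>. The two sides of each comparison differ by the positive factor
  \<open>cos \<alpha> * (1 - y \<bullet> polar_dir t)\<close>. The last two claims are the mirror
  image.\<close>

lemma proj_coord_tan:
  assumes "norm y < 1" and "cos \<alpha> > 0"
  shows "proj_coord t y \<le> tan \<alpha> \<longleftrightarrow> y \<bullet> polar_dir (t + pi / 2 - \<alpha>) \<le> sin \<alpha>"
    and "proj_coord t y = tan \<alpha> \<longleftrightarrow> y \<bullet> polar_dir (t + pi / 2 - \<alpha>) = sin \<alpha>"
    and "- tan \<alpha> \<le> proj_coord t y \<longleftrightarrow> y \<bullet> polar_dir (t - pi / 2 + \<alpha>) \<le> sin \<alpha>"
    and "proj_coord t y = - tan \<alpha> \<longleftrightarrow> y \<bullet> polar_dir (t - pi / 2 + \<alpha>) = sin \<alpha>"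
proof -
  let ?d = "1 - y \<bullet> polar_dir t"
  have d: "0 < ?d" using inner_polar_dir_less_1[OF assms(1), of t] by simp
  have e1: "y \<bullet> polar_dir (t + pi / 2 - \<alpha>) - sin \<alpha> = cos \<alpha> * ?d * (proj_coord t y - tan \<alpha>)"
  proof -
    have "cos \<alpha> * ?d * (proj_coord t y - tan \<alpha>)
        = cos \<alpha> * (y \<bullet> polar_dir (t + pi / 2)) - sin \<alpha> * ?d"
      using d assms(2) by (simp add: proj_coord_def tan_def field_simps)
    then show ?thesis
      by (simp add: inner_polar_dir cos_add sin_add cos_diff sin_diff algebra_simps)
  qed
  have e2: "y \<bullet> polar_dir (t - pi / 2 + \<alpha>) - sin \<alpha> = cos \<alpha> * ?d * (- proj_coord t y - tan \<alpha>)"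
  proof -
    have "cos \<alpha> * ?d * (- proj_coord t y - tan \<alpha>)
        = - cos \<alpha> * (y \<bullet> polar_dir (t + pi / 2)) - sin \<alpha> * ?d"
      using d assms(2) by (simp add: proj_coord_def tan_def field_simps)
    then show ?thesis
      by (simp add: inner_polar_dir cos_add sin_add cos_diff sin_diff algebra_simps)
  qed
  have c: "0 < cos \<alpha> * ?d" using d assms(2) by simp
  have le: "(c * x \<le> 0) = (x \<le> 0)" and eq: "(c * x = 0) = (x = 0)" if "0 < c" for c x :: real
    using that by (auto simp: mult_le_0_iff)
  show "proj_coord t y \<le> tan \<alpha> \<longleftrightarrow> y \<bullet> polar_dir (t + pi / 2 - \<alpha>) \<le> sin \<alpha>"
    using e1 le[OF c, of "proj_coord t y - tan \<alpha>"] by linarith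
  show "proj_coord t y = tan \<alpha> \<longleftrightarrow> y \<bullet> polar_dir (t + pi / 2 - \<alpha>) = sin \<alpha>"
    using e1 eq[OF c, of "proj_coord t y - tan \<alpha>"] by linarith
  show "- tan \<alpha> \<le> proj_coord t y \<longleftrightarrow> y \<bullet> polar_dir (t - pi / 2 + \<alpha>) \<le> sin \<alpha>"
    using e2 le[OF c, of "- proj_coord t y - tan \<alpha>"] by linarith
  show "proj_coord t y = - tan \<alpha> \<longleftrightarrow> y \<bullet> polar_dir (t - pi / 2 + \<alpha>) = sin \<alpha>"
    using e2 eq[OF c, of "- proj_coord t y - tan \<alpha>"] by linarith
qed

section \<open>Recognising a disc from its support values\<close>

text \<open>Testing \<open>y\<close> against its own direction bounds its norm by \<open>r\<close>.
  Conversely, a point of the ball outside \<open>K\<close> would be strictly separated from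
  \<open>K\<close>, yet \<open>K\<close> attains the value \<open>r\<close> along the outward normal
  \<open>- a\<close>, and no point of the ball exceeds it.\<close>

lemma constant_support_eq_cball:
  fixes K :: "(real ^ 2) set"
  assumes K: "closed K" "convex K"
    and le: "\<And>t y. y \<in> K \<Longrightarrow> y \<bullet> polar_dir t \<le> r"
    and eq: "\<And>t. \<exists>y\<in>K. y \<bullet> polar_dir t = r"
  shows "K = cball 0 r"
proof (intro equalityI subsetI)
  fix y assume y: "y \<in> K"
  obtain t where t: "y = norm y *\<^sub>R polar_dir t" by (rule polar_decomposition)
  then have "y \<bullet> polar_dir t = norm y * (polar_dir t \<bullet> polar_dir t)" by (metis inner_scaleR_left)
  then show "y \<in> cball 0 r" using le[OF y, of t] by (simp add: polar_dir_inner_polar_dir)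
next
  fix z :: "real ^ 2" assume z: "z \<in> cball 0 r"
  show "z \<in> K"
  proof (rule ccontr)
    assume "z \<notin> K"
    then obtain a b where ab: "a \<bullet> z < b" "\<forall>y\<in>K. b < a \<bullet> y"
      using separating_hyperplane_closed_point[OF K(2,1)] by blast
    obtain t where t: "- a = norm (- a) *\<^sub>R polar_dir t" by (rule polar_decomposition)
    obtain y where y: "y \<in> K" "y \<bullet> polar_dir t = r" using eq by blast
    have "(- a) \<bullet> y = norm a * r" by (subst t) (simp add: y(2) inner_commute)
    moreover have "(- a) \<bullet> z \<le> norm a * norm z" using norm_cauchy_schwarz[of "- a" z] by simp
    moreover have "norm a * norm z \<le> norm a * r" using z by (simp add: mult_left_mono)
    ultimately show False using ab y(1) by force
  qed
qed

section \<open>Rigidity of the constant section length\<close>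

theorem theorem4:
  fixes K :: "(real ^ 2) set"
  assumes "convex_body K"
    and "K \<subseteq> interior (cball 0 1)"
    and "\<exists>L::real. \<forall>x. x \<in> sphere 0 1 \<longrightarrow>
           (\<exists>a b. apex_cone K x \<inter> {y. orthogonal x y} = closed_segment a b \<and> dist a b = L)"
  shows "\<exists>c r. 0 < r \<and> K = cball c r"
proof -
  have K: "compact K" "convex K" "interior K \<noteq> {}" using assms(1) by (auto simp: convex_body_def)
  have ne: "K \<noteq> {}" using K(3) by auto
  have norm_less: "norm y < 1" if "y \<in> K" for y using assms(2) that by auto
  obtain L where L: "\<And>x. norm x = 1 \<Longrightarrow>
      \<exists>a b. apex_cone K x \<inter> {y. orthogonal x y} = closed_segment a b \<and> dist a b = L"
    using assms(3) by auto
  define M where "M t = (SUP y\<in>K. proj_coord t y)" for t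
  have cont2: "continuous_on (UNIV \<times> K) (\<lambda>(t, y). proj_coord t y)"
  proof -
    have "1 - y \<bullet> polar_dir t \<noteq> 0" if "y \<in> K" for y t
      using inner_polar_dir_less_1[OF norm_less[OF that], of t] by simp
    then show ?thesis
      unfolding proj_coord_def case_prod_beta inner_polar_dir
      by (intro continuous_intros) auto
  qed
  have contM: "continuous_on UNIV M"
    using continuous_on_SUP_compact[OF cont2 K(1) ne] by (simp add: M_def)
  have cont1: "continuous_on K (proj_coord t)" for t
    using continuous_on_compose2[OF cont2, of K "\<lambda>y. (t, y)"] by (auto simp: continuous_on_Pair)
  have max: "(\<forall>y\<in>K. proj_coord t y \<le> M t) \<and> (\<exists>y\<in>K. proj_coord t y = M t)" for t
  proof -
    obtain y where y: "y \<in> K" "\<forall>z\<in>K. proj_coord t z \<le> proj_coord t y"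
      using continuous_attains_sup[OF K(1) ne cont1] by blast
    then have "M t = proj_coord t y" unfolding M_def by (intro cSup_eq_maximum) auto
    then show ?thesis using y by auto
  qed
  have min: "(\<forall>y\<in>K. M t - L \<le> proj_coord t y) \<and> (\<exists>y\<in>K. proj_coord t y = M t - L)" for t
  proof -
    let ?u = "polar_dir (t + pi / 2)"
    obtain a b where ab: "(\<lambda>y. proj_coord t y *\<^sub>R ?u) ` K = closed_segment a b" "dist a b = L"
      using L[of "polar_dir t"] apex_cone_section[of K t] norm_less by auto
    have dist: "dist (p *\<^sub>R ?u) (q *\<^sub>R ?u) = \<bar>p - q\<bar>" for p q
      by (simp add: dist_norm flip: scaleR_diff_left)
    obtain y where y: "y \<in> K" "proj_coord t y = M t" using max by blast
    \<comment> \<open>Two points of a segment of length \<open>L\<close> are at most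
      \<open>L\<close> apart, and one of them can be taken at coordinate \<open>M t\<close>. The
      lower bound is attained because both endpoints come from points of \<open>K\<close>.\<close>
    have ge: "M t - L \<le> proj_coord t z" if "z \<in> K" for z
    proof -
      have "proj_coord t y *\<^sub>R ?u \<in> closed_segment a b" "proj_coord t z *\<^sub>R ?u \<in> closed_segment a b"
        using ab(1) y(1) that by auto
      then have "dist (proj_coord t y *\<^sub>R ?u) (proj_coord t z *\<^sub>R ?u) \<le> L"
        using dist_in_closed_segment[of _ a b] segment_furthest_le[of _ a b] ab(2)
        by (smt (verit) dist_norm dist_commute)
      then show ?thesis using dist y by simp
    qed
    have "a \<in> closed_segment a b" "b \<in> closed_segment a b" by auto
    then obtain p q where pq: "p \<in> K" "a = proj_coord t p *\<^sub>R ?u" "q \<in> K" "b = proj_coord t q *\<^sub>R ?u"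
      using ab(1) by (metis (no_types, lifting) imageE)
    then have "\<bar>proj_coord t p - proj_coord t q\<bar> = L" using ab(2) dist by simp
    moreover have "proj_coord t p \<le> M t" "proj_coord t q \<le> M t" using max pq by auto
    ultimately have "proj_coord t p = M t - L \<or> proj_coord t q = M t - L"
      using ge[OF pq(1)] ge[OF pq(3)] by linarith
    then show ?thesis using ge pq by blast
  qed
  have cos_pos: "0 < cos (arctan m)" for m by (simp add: cos_arctan add_pos_nonneg)
  have support: "(\<forall>y\<in>K. y \<bullet> polar_dir (t + pi / 2 - arctan (M t)) \<le> sin (arctan (M t))) \<and>
      (\<exists>y\<in>K. y \<bullet> polar_dir (t + pi / 2 - arctan (M t)) = sin (arctan (M t)))" for t
    using max[of t] proj_coord_tan(1,2)[OF norm_less cos_pos, of _ t "M t"]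
    unfolding tan_arctan by metis
  \<comment> \<open>Otherwise \<open>K\<close> would lie on a single line and have empty
    interior.\<close>
  have L0: "L \<noteq> 0"
  proof
    assume "L = 0"
    define \<alpha> where "\<alpha> = arctan (M 0)"
    have "proj_coord 0 y = tan \<alpha>" if "y \<in> K" for y
      using max[of 0] min[of 0] that \<open>L = 0\<close> by (force simp: \<alpha>_def tan_arctan)
    then have "K \<subseteq> {y. polar_dir (pi / 2 - \<alpha>) \<bullet> y = sin \<alpha>}"
      using proj_coord_tan(2)[OF norm_less cos_pos, of _ 0 "M 0"] by (auto simp: \<alpha>_def inner_commute)
    moreover have "polar_dir (pi / 2 - \<alpha>) \<noteq> 0" by (metis norm_polar_dir norm_zero zero_neq_one)
    ultimately show False using interior_mono interior_hyperplane K(3) by blast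
  qed
  have reflect: "M (t + (pi - 2 * arctan (M t))) = L - M t" for t
  proof -
    let ?\<alpha> = "arctan (M t)"
    let ?s = "t + (pi - 2 * ?\<alpha>)"
    \<comment> \<open>The support line through \<open>polar_dir t\<close> is also the line through
      \<open>polar_dir ?s\<close> with coordinate \<open>- M t\<close>: the normals agree. So
      \<open>- M t\<close> is the lower end of the section at \<open>?s\<close>.\<close>
    have angle: "?s - pi / 2 + ?\<alpha> = t + pi / 2 - ?\<alpha>" by (simp add: field_simps)
    have "(\<forall>y\<in>K. - M t \<le> proj_coord ?s y) \<and> (\<exists>y\<in>K. proj_coord ?s y = - M t)"
      using support[of t] proj_coord_tan(3,4)[where t = ?s and \<alpha> = ?\<alpha>, OF norm_less cos_pos]
      unfolding angle tan_arctan by metis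
    then show ?thesis using min[of ?s] by (smt (verit))
  qed
  define f where "f t = 2 * pi - 2 * (arctan (M t) + arctan (L - M t))" for t
  have invM: "M (t + f t) = M t" for t
  proof -
    have "t + f t = t + (pi - 2 * arctan (M t)) + (pi - 2 * arctan (L - M t))"
      by (simp add: f_def)
    then show ?thesis by (metis reflect diff_diff_eq2 add_diff_cancel_left')
  qed
  have perM: "M (t + 2 * pi) = M t" for t
    using polar_dir_periodic[of t] polar_dir_periodic[of "t + pi / 2"]
    by (simp add: M_def proj_coord_def add_ac)
  have constf: "f s = f t" for s t
  proof (rule self_translation_invariant_constant[where f = f and p = "2 * pi"])
    show "continuous_on UNIV f" unfolding f_def by (intro continuous_intros contM)
    show "f (t + 2 * pi) = f t" for t by (simp add: f_def perM)
    \<comment> \<open>\<open>f\<close> depends on \<open>t\<close> only through \<open>M t\<close>,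
      so it inherits the invariance.\<close>
    show "f (t + f t) = f t" for t by (simp only: f_def[of "t + f t"] invM) (simp add: f_def)
  qed simp
  have constM: "M s = M t" for s t
  proof -
    have False if less: "M s < M t" for s t
    proof -
      \<comment> \<open>An intermediate value of \<open>M\<close> supplies a third argument of the
        arctangent sum: it would have to lie both above and below \<open>L / 2\<close>.\<close>
      define c where "c = (M s + M t) / 2"
      have "connected (range M)" using connected_continuous_image[OF contM] by simp
      then have "c \<in> range M" using connected_contains_Icc[of "range M" "M s" "M t"] less
        by (auto simp: c_def)
      then obtain r where r: "M r = c" by auto
      have "M s < M r" "M r < M t" using less r by (auto simp: c_def)
      then show False
        using arctan_sum_stationary[OF L0, of "M s" "M r"] arctan_sum_stationary[OF L0, of "M r" "M t"]
          constf[of s r] constf[of r t] by (auto simp: f_def)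
    qed
    then show ?thesis by (meson linorder_neqE_linordered_idom)
  qed
  define r where "r = sin (arctan (M 0))"
  have "K = cball 0 r"
  proof (rule constant_support_eq_cball)
    fix t
    \<comment> \<open>This is the apex whose upper support line has its normal at angle
      \<open>t\<close>.\<close>
    have *: "(t - pi / 2 + arctan (M 0)) + pi / 2 - arctan (M 0) = t" by simp
    have "M (t - pi / 2 + arctan (M 0)) = M 0" by (rule constM)
    with support[of "t - pi / 2 + arctan (M 0)"]
    show "\<exists>y\<in>K. y \<bullet> polar_dir t = r" "\<And>y. y \<in> K \<Longrightarrow> y \<bullet> polar_dir t \<le> r"
      unfolding r_def by (auto simp: *)
  qed (use K compact_imp_closed in auto)
  moreover have "0 < r"
    using K(3) \<open>K = cball 0 r\<close> by (auto simp: interior_cball)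
  ultimately show ?thesis by blast
qed

end
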